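(* Let $p$ be a prime with $p\equiv\pm1\pmod 8$, let $C$ be the quadratic residue code associated with $p$, and let $d$ be the minimum distance of $C$. Then the weight polynomial $A_C(x,y)$ is divisible by $(x+y)^d$.
   Context: Let $Q\subset\mathbb{F}_p$ be the set of (nonzero) quadratic residues and $N$ the set of quadratic non-residues. For $S\subseteq\mathbb{F}_p$ put $r_S=\sum_{a\in S}x^a\in\mathbb{F}_2[x]/(x^p-1)$; elements of this ring are identified with vectors of $\mathbb{F}_2^p$ via their coefficients. For $p\equiv\pm1\pmod 8$, the quadratic residue code associated with $p$ is the binary linear code of length $p$ and dimension $(p+1)/2$ given by the ideal of $\mathbb{F}_2[x]/(x^p-1)$ generated by $r_Q$ and the all-one element $\sum_{i=0}^{p-1}x^i$ (using $r_N$ in place of $r_Q$ gives an equivalent code, so has the same weight polynomial). When $p\equiv-1\pmod 8$ the ideal generated by $r_Q$ alone already contains the all-one element. The minimum distance of a linear code is its minimum nonzero weight. The weight polynomial of a binary code $C$ of length $n$ is $A_C(x,y)=\sum_{i=0}^n A_ix^{n-i}y^i$, where $A_i$ is the number of codewords of weight $i$. *)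

theory Defs
  imports
    "HOL-Library.Z2"
    "HOL-Computational_Algebra.Polynomial"
    "HOL-Number_Theory.Number_Theory"
    "HOL-Algebra.QuotRing"
    "Jordan_Normal_Form.Matrix"
    "Jordan_Normal_Form.VS_Connect"
begin

section \<open>Binary codes\<close>

text \<open>A binary code of length \<open>n\<close> is a subset of \<open>carrier_vec n :: bit vec set\<close>.\<close>

definition hamming_weight :: "bit vec \<Rightarrow> nat" where
  "hamming_weight v = card {i. i < dim_vec v \<and> v $ i \<noteq> 0}"

text \<open>The minimum is only meaningful if the code contains a nonzero word.\<close>

definition min_distance :: "bit vec set \<Rightarrow> nat" where
  "min_distance C = Min (hamming_weight ` C - {0})"

definition weight_count :: "bit vec set \<Rightarrow> nat \<Rightarrow> nat" where
  "weight_count C i = card {c \<in> C. hamming_weight c = i}"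

text \<open>The ring of polynomials in two variables over the integers is rendered as
  \<open>int poly poly\<close>: \<open>x\<close> is the variable of the coefficient ring and \<open>y\<close> the outer variable.\<close>

definition var_x :: "int poly poly" where
  "var_x = [:[:0, 1:]:]"

definition var_y :: "int poly poly" where
  "var_y = [:0, 1:]"

definition weight_polynomial :: "nat \<Rightarrow> bit vec set \<Rightarrow> int poly poly" where
  "weight_polynomial n C =
     (\<Sum>i = 0..n. of_nat (weight_count C i) * var_x ^ (n - i) * var_y ^ i)"


section \<open>The ring \<open>F\<^sub>2[x]/(x\<^sup>p - 1)\<close>\<close>

text \<open>Here \<open>class_ring\<close> is the type class ring \<open>bit poly\<close> with carrier \<open>UNIV\<close>.\<close>

definition cyclic_modulus :: "nat \<Rightarrow> bit poly set" where
  "cyclic_modulus p = PIdl\<^bsub>class_ring\<^esub> (Polynomial.monom 1 p - 1)"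

definition cyclic_ring :: "nat \<Rightarrow> bit poly set ring" where
  "cyclic_ring p = class_ring Quot (cyclic_modulus p)"

definition residue_class :: "nat \<Rightarrow> bit poly \<Rightarrow> bit poly set" where
  "residue_class p f = cyclic_modulus p +>\<^bsub>class_ring\<^esub> f"

text \<open>The identification of \<open>F\<^sub>2\<^sup>p\<close> with \<open>F\<^sub>2[x]/(x\<^sup>p - 1)\<close>: the vector
  \<open>(v\<^sub>0, \<dots>, v\<^sub>p\<^sub>-\<^sub>1)\<close> corresponds to the class of \<open>\<Sum>i<p. v\<^sub>i x\<^sup>i\<close>.\<close>

definition ring_element_of_vec :: "nat \<Rightarrow> bit vec \<Rightarrow> bit poly set" where
  "ring_element_of_vec p v = residue_class p (\<Sum>i<p. Polynomial.monom (v $ i) i)"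

definition code_of_ideal :: "nat \<Rightarrow> bit poly set set \<Rightarrow> bit vec set" where
  "code_of_ideal p I = {v \<in> carrier_vec p. ring_element_of_vec p v \<in> I}"


section \<open>Quadratic residue codes\<close>

text \<open>Elements of \<open>F\<^sub>p\<close> are represented by their least nonnegative residues.\<close>

definition quadratic_residues :: "nat \<Rightarrow> nat set" where
  "quadratic_residues p = {a. 0 < a \<and> a < p \<and> QuadRes (int p) (int a)}"

definition r_elem :: "nat \<Rightarrow> nat set \<Rightarrow> bit poly set" where
  "r_elem p S = residue_class p (\<Sum>a\<in>S. Polynomial.monom 1 a)"

text \<open>The all-one element \<open>1 + x + \<dots> + x\<^sup>p\<^sup>-\<^sup>1\<close> is \<open>r_elem p {0..<p}\<close>.\<close>

definition qr_code :: "nat \<Rightarrow> bit vec set" where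
  "qr_code p = code_of_ideal p
     (Idl\<^bsub>cyclic_ring p\<^esub> {r_elem p (quadratic_residues p), r_elem p {0..<p}})"

end

theory Submission
  imports Defs
begin

text \<open>Up to a constant, the MacWilliams identity writes \<open>A\<^sub>C(x, y)\<close> as the sum of
  \<open>(x + y)\<^bsup>p - |w|\<^esup> (x - y)\<^bsup>|w|\<^esup>\<close> over the dual words \<open>w\<close>, so it suffices that no dual word has
  weight exceeding \<open>p - d\<close>. Every dual word \<open>w\<close> is, after multiplying the coordinates by a suitable
  unit of \<open>F\<^sub>p\<close>, a word of \<open>C\<close>. As \<open>C\<close> contains the all-one word, the complement of the permuted
  word lies in \<open>C\<close> and has weight \<open>p - |w|\<close>, which is therefore \<open>0\<close> or at least \<open>d\<close>; it is not
  \<open>0\<close>, since \<open>w\<close> is orthogonal to the all-one word and \<open>p\<close> is odd.\<close>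

section \<open>The MacWilliams identity and divisibility\<close>

text \<open>Bits must stay in ring notation: rewriting them to xor and conjunction would block the
  ring and sum lemmas.\<close>

declare add_bit_eq_xor [simp del] mult_bit_eq_and [simp del]

text \<open>The additive character \<open>b\<close> -> (-1)^\<open>b\<close> of F_2. The target ring
  is left general so that it can be instantiated with \<open>int poly poly\<close>.\<close>

definition bit_sign :: "bit \<Rightarrow> 'a::comm_ring_1" where
  "bit_sign b = (if b = 0 then 1 else - 1)"

lemma bit_sign_simps [simp]: "bit_sign 0 = 1" "bit_sign 1 = - 1"
  by (simp_all add: bit_sign_def)

lemma bit_sign_add: "bit_sign (a + b) = bit_sign a * bit_sign b"
  by (cases a; cases b) simp_all

lemma bit_sign_sum: "bit_sign (\<Sum>i\<in>A. f i) = (\<Prod>i\<in>A. bit_sign (f i))"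
  by (induction A rule: infinite_finite_induct) (simp_all add: bit_sign_add)

lemma bit_vec_add_cancel:
  fixes u v :: "bit vec"
  assumes "u \<in> carrier_vec n" "v \<in> carrier_vec n"
  shows "(u + v) + v = u"
proof -
  have "(a + b) + b = a" for a b :: bit
    by (cases b) (simp_all add: add.assoc)
  then show ?thesis
    by (intro eq_vecI) (use assms in auto)
qed

lemma finite_carrier_vec_bit: "finite (carrier_vec n :: bit vec set)"
proof -
  have "(UNIV :: bit set) = {0, 1}"
    by auto
  then have "finite (UNIV :: bit set)"
    by (metis finite.emptyI finite.insertI)
  then have "finite ({xs :: bit list. set xs \<subseteq> UNIV \<and> length xs = n})"
    by (rule finite_lists_length_eq)
  then have "finite (vec_of_list ` {xs :: bit list. set xs \<subseteq> UNIV \<and> length xs = n})"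
    by (rule finite_imageI)
  moreover have "carrier_vec n \<subseteq> vec_of_list ` {xs :: bit list. set xs \<subseteq> UNIV \<and> length xs = n}"
  proof
    fix v :: "bit vec" assume "v \<in> carrier_vec n"
    then show "v \<in> vec_of_list ` {xs. set xs \<subseteq> UNIV \<and> length xs = n}"
      by (intro image_eqI[of _ _ "list_of_vec v"]) (auto simp: vec_list)
  qed
  ultimately show ?thesis
    by (rule rev_finite_subset)
qed

text \<open>Orthogonality of characters: translation by \<open>c\<close> is an involution of
  \<open>C\<close> that flips the sign of every term. The sum thus equals its own negative, and 2
  can be cancelled in characteristic 0.\<close>

lemma sum_bit_sign_eq_0:
  fixes C :: "bit vec set"
  assumes C: "C \<subseteq> carrier_vec n"
    and add: "\<And>u v. u \<in> C \<Longrightarrow> v \<in> C \<Longrightarrow> u + v \<in> C"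
    and S: "S \<subseteq> {..<n}"
    and c: "c \<in> C" "(\<Sum>i\<in>S. c $ i) \<noteq> 0"
  shows "(\<Sum>u\<in>C. bit_sign (\<Sum>i\<in>S. u $ i)) = (0 :: 'a :: {idom, ring_char_0})"
proof -
  let ?T = "\<Sum>u\<in>C. bit_sign (\<Sum>i\<in>S. u $ i) :: 'a"
  have cancel: "(u + c) + c = u" if "u \<in> C" for u
    using that C c(1) by (intro bit_vec_add_cancel) auto
  have "?T = (\<Sum>u\<in>C. bit_sign (\<Sum>i\<in>S. (u + c) $ i))"
    by (rule sum.reindex_bij_witness[of C "\<lambda>u. u + c" "\<lambda>u. u + c"])
      (simp_all add: cancel add c(1))
  also have "\<dots> = (\<Sum>u\<in>C. - bit_sign (\<Sum>i\<in>S. u $ i))"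
  proof (rule sum.cong)
    fix u assume u: "u \<in> C"
    have "(\<Sum>i\<in>S. (u + c) $ i) = (\<Sum>i\<in>S. u $ i + c $ i)"
      by (rule sum.cong) (use C S c u in \<open>auto simp: subset_iff\<close>)
    then show "bit_sign (\<Sum>i\<in>S. (u + c) $ i) = - (bit_sign (\<Sum>i\<in>S. u $ i) :: 'a)"
      using c(2) by (simp add: sum.distrib bit_sign_add)
  qed simp
  finally have "?T + ?T = 0"
    by (simp add: sum_negf)
  then have "2 * ?T = 0"
    by (simp only: mult_2)
  then show ?thesis
    by simp
qed

lemma hamming_weight_le: "hamming_weight v \<le> dim_vec v"
  unfolding hamming_weight_def by (rule order.trans[OF card_mono[of "{..<dim_vec v}"]]) auto

lemma monomial_eq_prod:
  fixes a b :: "'a::comm_monoid_mult"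
  assumes "v \<in> carrier_vec n"
  shows "a ^ (n - hamming_weight v) * b ^ hamming_weight v = (\<Prod>i<n. if v $ i = 0 then a else b)"
proof -
  let ?B = "{i. i < n \<and> v $ i \<noteq> 0}"
  have "{..<n} \<inter> {i. v $ i = 0} = {..<n} - ?B"
    by auto
  moreover have "card ({..<n} - ?B) = n - card ?B"
    by (subst card_Diff_subset) auto
  moreover have "{..<n} \<inter> - {i. v $ i = 0} = ?B"
    by auto
  ultimately show ?thesis
    using assms by (simp add: prod.If_cases hamming_weight_def del: bit_not_zero_iff)
qed

text \<open>Codewords are grouped by weight. Having one factor per coordinate is what allows the
  MacWilliams expansion to act coordinate by coordinate.\<close>

lemma weight_polynomial_eq_sum:
  assumes "C \<subseteq> carrier_vec n"
  shows "weight_polynomial n C = (\<Sum>c\<in>C. \<Prod>i<n. if c $ i = 0 then var_x else var_y)"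
proof -
  have fin: "finite C"
    using assms finite_carrier_vec_bit finite_subset by blast
  have "(\<Sum>c\<in>C. \<Prod>i<n. if c $ i = 0 then var_x else var_y)
      = (\<Sum>c\<in>C. var_x ^ (n - hamming_weight c) * var_y ^ hamming_weight c)"
    by (intro sum.cong refl monomial_eq_prod[symmetric] subsetD[OF assms])
  also have "\<dots> = (\<Sum>i\<in>{0..n}. \<Sum>c\<in>{c \<in> C. hamming_weight c = i}.
      var_x ^ (n - hamming_weight c) * var_y ^ hamming_weight c)"
  proof (rule sum.group[symmetric])
    show "hamming_weight ` C \<subseteq> {0..n}"
    proof (rule image_subsetI)
      fix c assume "c \<in> C"
      then have "dim_vec c = n"
        using assms by auto
      then show "hamming_weight c \<in> {0..n}"
        using hamming_weight_le[of c] by simp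
    qed
  qed (simp_all add: fin)
  also have "\<dots> = (\<Sum>i\<in>{0..n}. \<Sum>c\<in>{c \<in> C. hamming_weight c = i}. var_x ^ (n - i) * var_y ^ i)"
    by (intro sum.cong) auto
  finally show ?thesis
    by (simp add: weight_polynomial_def weight_count_def mult.assoc)
qed

text \<open>In each coordinate, twice the factor is (a + b) + (a - b) or (a + b) - (a - b),
  according to the bit. Multiplying out, \<open>S\<close> collects the coordinates where the term
  with a - b is chosen, and their signs combine into a single character value.\<close>

lemma MacWilliams_expansion:
  fixes a b :: "'a::comm_ring_1"
  shows "2 ^ n * (\<Sum>c\<in>C. \<Prod>i<n. if c $ i = 0 then a else b)
    = (\<Sum>S\<in>Pow {..<n}. (\<Sum>c\<in>C. bit_sign (\<Sum>i\<in>S. c $ i))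
        * ((a - b) ^ card S * (a + b) ^ (n - card S)))"
proof -
  have "2 ^ n * (\<Prod>i<n. if c $ i = 0 then a else b)
      = (\<Sum>S\<in>Pow {..<n}. bit_sign (\<Sum>i\<in>S. c $ i) * ((a - b) ^ card S * (a + b) ^ (n - card S)))"
    for c :: "bit vec"
  proof -
    have "2 ^ n * (\<Prod>i<n. if c $ i = 0 then a else b)
        = (\<Prod>i<n. 2 * (if c $ i = 0 then a else b))"
      by (simp add: prod.distrib)
    also have "\<dots> = (\<Prod>i<n. bit_sign (c $ i) * (a - b) + (a + b))"
      by (intro prod.cong) (auto simp: bit_sign_def)
    also have "\<dots> = (\<Sum>S\<in>Pow {..<n}. (\<Prod>i\<in>S. bit_sign (c $ i) * (a - b)) * (\<Prod>i\<in>{..<n} - S. a + b))"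
      by (rule prod_add) simp
    also have "\<dots> = (\<Sum>S\<in>Pow {..<n}. bit_sign (\<Sum>i\<in>S. c $ i) * ((a - b) ^ card S * (a + b) ^ (n - card S)))"
      by (intro sum.cong)
        (auto simp: prod.distrib bit_sign_sum card_Diff_subset finite_subset mult.assoc)
    finally show ?thesis .
  qed
  then show ?thesis
    by (simp add: sum_distrib_left sum_distrib_right sum.swap[of _ _ C])
qed

text \<open>Pseudo-division by a monic \<open>g\<close> is true division with remainder, even though
  the coefficients need not form a field. The remainder \<open>r\<close> satisfies
  \<open>g dvd smult k r\<close>, and comparing degrees forces \<open>r = 0\<close>.\<close>

lemma monic_dvd_smult_cancel:
  fixes f g :: "'a::idom poly"
  assumes "lead_coeff g = 1" "k \<noteq> 0" "g dvd Polynomial.smult k f"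
  shows "g dvd f"
proof -
  have g: "g \<noteq> 0"
    using assms(1) by auto
  obtain q r where qr: "pseudo_divmod f g = (q, r)"
    by force
  have f: "f = g * q + r" and r: "r = 0 \<or> Polynomial.degree r < Polynomial.degree g"
    using pseudo_divmod[OF g qr] assms(1) by simp_all
  have "Polynomial.smult k f = g * Polynomial.smult k q + Polynomial.smult k r"
    by (simp add: f smult_add_right)
  then have "g dvd Polynomial.smult k r"
    using assms(3) by (metis dvd_add_right_iff dvd_triv_left)
  then have "r = 0"
    using r assms(2) dvd_imp_degree_le[of g "Polynomial.smult k r"] by fastforce
  with f show ?thesis
    by simp
qed

text \<open>In the outer variable y the polynomial x + y is monic, hence so are its powers, while
  2^n is a nonzero constant of the coefficient ring.\<close>

lemma var_sum_power_dvd_cancel: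
  assumes "(var_x + var_y) ^ d dvd 2 ^ n * f"
  shows "(var_x + var_y) ^ d dvd f"
proof (rule monic_dvd_smult_cancel)
  show "lead_coeff ((var_x + var_y) ^ d) = 1"
    by (simp only: lead_coeff_power) (simp add: var_x_def var_y_def)
  have "(2 ^ n :: int poly poly) = [:2 ^ n:]"
    by (induction n) (simp_all add: numeral_poly)
  then show "(var_x + var_y) ^ d dvd Polynomial.smult (2 ^ n) f"
    using assms by simp
qed simp

text \<open>Words of the dual code are given by their supports \<open>S\<close>.\<close>

lemma power_dvd_weight_polynomial:
  assumes C: "C \<subseteq> carrier_vec n"
    and add: "\<And>u v. u \<in> C \<Longrightarrow> v \<in> C \<Longrightarrow> u + v \<in> C"
    and dual: "\<And>S. S \<subseteq> {..<n} \<Longrightarrow> \<forall>c\<in>C. (\<Sum>i\<in>S. c $ i) = 0 \<Longrightarrow> card S + d \<le> n"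
  shows "(var_x + var_y) ^ d dvd weight_polynomial n C"
proof (rule var_sum_power_dvd_cancel)
  show "(var_x + var_y) ^ d dvd 2 ^ n * weight_polynomial n C"
    unfolding weight_polynomial_eq_sum[OF C] MacWilliams_expansion
  proof (rule dvd_sum)
    fix S assume S: "S \<in> Pow {..<n}"
    show "(var_x + var_y) ^ d dvd (\<Sum>c\<in>C. bit_sign (\<Sum>i\<in>S. c $ i))
        * ((var_x - var_y) ^ card S * (var_x + var_y) ^ (n - card S))"
    \<comment> \<open>If \<open>S\<close> supports a dual word, \<open>dual\<close> leaves at least
      \<open>d\<close> factors x + y in the term; otherwise its character sum vanishes.\<close>
    proof (cases "\<forall>c\<in>C. (\<Sum>i\<in>S. c $ i) = 0")
      case True
      then have "d \<le> n - card S"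
        using dual[of S] S by auto
      then show ?thesis
        by (intro dvd_mult le_imp_power_dvd)
    next
      case False
      then obtain c where "c \<in> C" "(\<Sum>i\<in>S. c $ i) \<noteq> 0"
        by blast
      then have "(\<Sum>u\<in>C. bit_sign (\<Sum>i\<in>S. u $ i)) = (0 :: int poly poly)"
        using S by (intro sum_bit_sign_eq_0[OF C add]) auto
      then show ?thesis
        by simp
    qed
  qed
qed

section \<open>Ideals of the cyclic ring\<close>

lemma cring_class_ring: "cring (class_ring :: 'a::comm_ring_1 ring)"
  by (rule class_cring.is_cring)

lemma ideal_cyclic_modulus: "ideal (cyclic_modulus p) class_ring"
  unfolding cyclic_modulus_def by (rule cring.cgenideal_ideal[OF cring_class_ring]) simp

lemma residue_class_in_carrier: "residue_class p f \<in> carrier (cyclic_ring p)"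
  unfolding residue_class_def cyclic_ring_def
  using ring_hom_closed[OF ideal.rcos_ring_hom[OF ideal_cyclic_modulus], of f p] by simp

lemma residue_class_add:
  "residue_class p (f + g) = residue_class p f \<oplus>\<^bsub>cyclic_ring p\<^esub> residue_class p g"
  unfolding residue_class_def cyclic_ring_def
  using ring_hom_add[OF ideal.rcos_ring_hom[OF ideal_cyclic_modulus], of f g p] by simp

lemma residue_class_mult:
  "residue_class p (f * g) = residue_class p f \<otimes>\<^bsub>cyclic_ring p\<^esub> residue_class p g"
  unfolding residue_class_def cyclic_ring_def
  using ring_hom_mult[OF ideal.rcos_ring_hom[OF ideal_cyclic_modulus], of f g p] by simp

lemma residue_class_cong:
  assumes "Polynomial.monom 1 p - 1 dvd f - g"
  shows "residue_class p f = residue_class p g"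
proof -
  have "f - g \<in> cyclic_modulus p"
    using assms by (auto simp: cyclic_modulus_def cgenideal_def dvd_def mult.commute)
  then show ?thesis
    unfolding residue_class_def
    using ring.quotient_eq_iff_same_a_r_cos[OF cring.axioms(1)[OF cring_class_ring]
        ideal_cyclic_modulus, of f g p]
    by (simp add: class_ring_simps)
qed

lemma ring_cyclic_ring: "ring (cyclic_ring p)"
  unfolding cyclic_ring_def by (rule ideal.quotient_is_ring[OF ideal_cyclic_modulus])

section \<open>Words of the quadratic residue code\<close>

abbreviation (input) qr_ideal :: "nat \<Rightarrow> bit poly set set" where
  "qr_ideal p \<equiv> Idl\<^bsub>cyclic_ring p\<^esub> {r_elem p (quadratic_residues p), r_elem p {0..<p}}"

lemma qr_code_iff:
  "v \<in> qr_code p \<longleftrightarrow> v \<in> carrier_vec p \<and>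
    residue_class p (\<Sum>i<p. Polynomial.monom (v $ i) i) \<in> qr_ideal p"
  by (simp add: qr_code_def code_of_ideal_def ring_element_of_vec_def)

lemma ideal_qr_ideal: "ideal (qr_ideal p) (cyclic_ring p)"
  by (rule ring.genideal_ideal[OF ring_cyclic_ring]) (simp add: r_elem_def residue_class_in_carrier)

lemma generators_in_qr_ideal:
  "r_elem p (quadratic_residues p) \<in> qr_ideal p" "r_elem p {0..<p} \<in> qr_ideal p"
  using ring.genideal_self[OF ring_cyclic_ring, of "{r_elem p (quadratic_residues p), r_elem p {0..<p}}"]
  by (simp_all add: r_elem_def residue_class_in_carrier)

lemma qr_code_subset: "qr_code p \<subseteq> carrier_vec p"
  by (auto simp: qr_code_iff)

lemma qr_code_add:
  assumes "u \<in> qr_code p" "v \<in> qr_code p"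
  shows "u + v \<in> qr_code p"
proof -
  have "(\<Sum>i<p. Polynomial.monom ((u + v) $ i) i)
      = (\<Sum>i<p. Polynomial.monom (u $ i) i) + (\<Sum>i<p. Polynomial.monom (v $ i) i)"
    unfolding sum.distrib[symmetric]
    by (intro sum.cong) (use assms in \<open>auto simp: qr_code_iff add_monom\<close>)
  then show ?thesis
    using assms additive_subgroup.a_closed[OF ideal.axioms(1)[OF ideal_qr_ideal]]
    by (simp add: qr_code_iff residue_class_add)
qed

lemma qr_code_all_one: "vec p (\<lambda>_. 1) \<in> qr_code p"
  using generators_in_qr_ideal(2) by (simp add: qr_code_iff r_elem_def atLeast0LessThan)

lemma Legendre_cong: "[a = b] (mod q) \<Longrightarrow> Legendre a q = Legendre b q"
  by (simp add: Legendre_def QuadRes_def cong_def)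

lemma Legendre_eq_1_iff:
  assumes "p > 0"
  shows "Legendre z (int p) = 1 \<longleftrightarrow> nat (z mod int p) \<in> quadratic_residues p"
proof -
  have "Legendre z (int p) = 1 \<longleftrightarrow> Legendre (z mod int p) (int p) = 1"
    by (simp add: Legendre_def QuadRes_def cong_def)
  also have "\<dots> \<longleftrightarrow> nat (z mod int p) \<in> quadratic_residues p"
  proof (cases "z mod int p = 0")
    case False
    then have "0 < z mod int p"
      using assms pos_mod_sign[of "int p" z] by linarith
    then show ?thesis
      using assms False
      by (auto simp: Legendre_def quadratic_residues_def cong_def nat_less_iff)
  qed (simp add: Legendre_def quadratic_residues_def)
  finally show ?thesis .
qed

text \<open>This is the coefficient vector of x^k r_Q modulo x^p - 1, because its support is the
  translate Q + k; an ideal absorbs the factor x^k.\<close>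

lemma qr_code_shift:
  assumes p: "p > 0"
  shows "vec p (\<lambda>i. of_bool (Legendre (int i - int k) (int p) = 1)) \<in> qr_code p"
proof -
  let ?Q = "quadratic_residues p"
  let ?s = "\<lambda>a. (a + k) mod p"
  have Q: "?Q \<subseteq> {..<p}"
    by (auto simp: quadratic_residues_def)
  then have fin: "finite ?Q"
    by (rule finite_subset) simp
  have inj: "inj_on ?s ?Q"
  proof (rule inj_onI)
    fix a b assume ab: "a \<in> ?Q" "b \<in> ?Q" "?s a = ?s b"
    then have "[a = b] (mod p)"
      by (simp flip: cong_def add: cong_add_rcancel_nat)
    moreover have "a < p" "b < p"
      using ab Q by auto
    ultimately show "a = b"
      by (simp add: cong_def)
  qed
  have img: "{i \<in> {..<p}. Legendre (int i - int k) (int p) = 1} = ?s ` ?Q"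
  proof safe
    fix i assume i: "i < p" "Legendre (int i - int k) (int p) = 1"
    let ?a = "nat ((int i - int k) mod int p)"
    have "int (?s ?a) = int i"
      using p i(1) by (simp add: zmod_int mod_add_left_eq)
    then have "i = ?s ?a"
      by simp
    moreover have "?a \<in> ?Q"
      using i(2) p by (simp add: Legendre_eq_1_iff)
    ultimately show "i \<in> ?s ` ?Q"
      by blast
  next
    fix a assume a: "a \<in> ?Q"
    have "(int (?s a) - int k) mod int p = int a mod int p"
      by (simp add: zmod_int mod_diff_left_eq)
    moreover have "int a mod int p = int a"
      using a Q by auto
    ultimately show "Legendre (int (?s a) - int k) (int p) = 1"
      using a p by (simp add: Legendre_eq_1_iff)
  qed (use p in simp)
  have "(\<Sum>i<p. Polynomial.monom (of_bool (Legendre (int i - int k) (int p) = 1) :: bit) i)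
      = (\<Sum>i<p. if Legendre (int i - int k) (int p) = 1 then Polynomial.monom 1 i else 0)"
    by (intro sum.cong) auto
  also have "\<dots> = (\<Sum>i\<in>?s ` ?Q. Polynomial.monom 1 i)"
    by (simp only: sum.inter_filter[symmetric] finite_lessThan img)
  also have "\<dots> = (\<Sum>a\<in>?Q. Polynomial.monom 1 (?s a))"
    by (simp add: sum.reindex[OF inj])
  finally have eq: "(\<Sum>i<p. Polynomial.monom (of_bool (Legendre (int i - int k) (int p) = 1) :: bit) i)
      = (\<Sum>a\<in>?Q. Polynomial.monom 1 (?s a))" .
  \<comment> \<open>Exponents may be reduced modulo \<open>p\<close>: with q the quotient of a + k
    by p, the difference of the two monomials is a multiple of (x^p)^q - 1, which x^p - 1
    divides.\<close>
  have "Polynomial.monom 1 p - 1 dvd (\<Sum>a\<in>?Q. Polynomial.monom (1 :: bit) (a + k) - Polynomial.monom 1 (?s a))"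
  proof (rule dvd_sum)
    fix a
    let ?q = "(a + k) div p"
    have "Polynomial.monom (1 :: bit) (a + k) = Polynomial.monom 1 (p * ?q + ?s a)"
      by simp
    also have "\<dots> = Polynomial.monom 1 p ^ ?q * Polynomial.monom 1 (?s a)"
      by (simp only: monom_power mult_monom) simp
    finally have "Polynomial.monom (1 :: bit) (a + k) - Polynomial.monom 1 (?s a)
        = (Polynomial.monom 1 p ^ ?q - 1 ^ ?q) * Polynomial.monom 1 (?s a)"
      by (simp add: left_diff_distrib)
    then show "Polynomial.monom 1 p - 1 dvd Polynomial.monom (1 :: bit) (a + k) - Polynomial.monom 1 (?s a)"
      by (simp only: power_diff_sumr2 mult.assoc dvd_triv_left)
  qed
  then have "residue_class p (\<Sum>a\<in>?Q. Polynomial.monom 1 (?s a))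
      = residue_class p (\<Sum>a\<in>?Q. Polynomial.monom 1 (a + k))"
    by (intro residue_class_cong[symmetric]) (simp only: sum_subtractf)
  also have "(\<Sum>a\<in>?Q. Polynomial.monom (1 :: bit) (a + k))
      = Polynomial.monom 1 k * (\<Sum>a\<in>?Q. Polynomial.monom 1 a)"
    by (simp add: sum_distrib_left mult_monom add.commute)
  also have "residue_class p \<dots> \<in> qr_ideal p"
    using ideal.I_l_closed[OF ideal_qr_ideal generators_in_qr_ideal(1)] residue_class_in_carrier
    by (simp add: residue_class_mult r_elem_def)
  finally show ?thesis
    using eq by (simp add: qr_code_iff)
qed

lemma qr_code_sum:
  assumes "finite K" "\<And>k. k \<in> K \<Longrightarrow> vec p (g k) \<in> qr_code p"
  shows "vec p (\<lambda>i. \<Sum>k\<in>K. g k i) \<in> qr_code p"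
  using assms
proof (induction K)
  case empty
  \<comment> \<open>In characteristic 2 the zero word is twice the all-one word, so closure under
    addition covers the empty sum.\<close>
  have "vec p (\<lambda>_. 1) + vec p (\<lambda>_. 1) = (vec p (\<lambda>_. 0) :: bit vec)"
    by (rule eq_vecI) auto
  then show ?case
    using qr_code_add[OF qr_code_all_one qr_code_all_one, of p] by simp
next
  case (insert k K)
  have "vec p (\<lambda>i. \<Sum>k\<in>insert k K. g k i) = vec p (g k) + vec p (\<lambda>i. \<Sum>k\<in>K. g k i)"
    by (rule eq_vecI) (use insert.hyps in auto)
  then show ?case
    using insert by (auto intro: qr_code_add)
qed

section \<open>Supports of dual words\<close>

text \<open>By the Euler criterion both sides agree modulo \<open>p\<close>. Both lie in {-1, 0, 1},
  so they differ by at most 2, which is less than \<open>p\<close>.\<close>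

lemma Legendre_mult:
  fixes p :: nat
  assumes "prime p" "2 < p"
  shows "Legendre (a * b) (int p) = Legendre a (int p) * Legendre b (int p)"
proof -
  let ?d = "Legendre (a * b) (int p) - Legendre a (int p) * Legendre b (int p)"
  have "[Legendre a (int p) * Legendre b (int p) = a ^ ((p - 1) div 2) * b ^ ((p - 1) div 2)] (mod int p)"
    by (intro cong_mult euler_criterion assms)
  then have "[Legendre (a * b) (int p) = Legendre a (int p) * Legendre b (int p)] (mod int p)"
    using euler_criterion[OF assms, of "a * b"] by (metis cong_sym cong_trans power_mult_distrib)
  then have "int p dvd ?d"
    by (simp add: cong_iff_dvd_diff)
  moreover have "\<bar>?d\<bar> < int p"
    using assms(2) by (auto simp: Legendre_def)
  ultimately show ?thesis
    using dvd_imp_le_int[of ?d "int p"] by fastforce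
qed

text \<open>Squaring modulo \<open>q\<close> sends both 1 and q - 1 to 1. Not being injective on the
  finite set of nonzero residues, it cannot cover that set.\<close>

lemma exists_quadratic_nonresidue:
  assumes "prime q" "2 < (q :: int)"
  shows "\<exists>n. Legendre n q = - 1"
proof -
  let ?f = "\<lambda>x. x\<^sup>2 mod q"
  have "(q - 1)\<^sup>2 = 1 + q * (q - 2)"
    by (simp add: power2_eq_square algebra_simps)
  then have "?f (q - 1) = ?f 1"
    by simp
  then have "\<not> inj_on ?f {1..<q}"
    using assms(2) by (auto dest!: inj_onD[of _ _ "q - 1" 1])
  then have "\<not> {1..<q} \<subseteq> ?f ` {1..<q}"
    using finite_surj_inj[of "{1..<q}" ?f] by auto
  then obtain z where z: "z \<in> {1..<q}" "z \<notin> ?f ` {1..<q}"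
    by blast
  then have "\<not> [z = 0] (mod q)"
    by (auto simp: cong_def)
  moreover have "\<not> QuadRes q z"
  proof
    assume "QuadRes q z"
    then obtain y where "y\<^sup>2 mod q = z"
      using z(1) by (auto simp: QuadRes_def cong_def)
    then have y: "?f (y mod q) = z"
      by (simp add: power_mod)
    then have "y mod q \<noteq> 0"
      using z(1) by auto
    then have "y mod q \<in> {1..<q}"
      using assms(2) pos_mod_bound[of q y] pos_mod_sign[of q y] unfolding atLeastLessThan_iff
      by linarith
    then show False
      using y z(2) by blast
  qed
  ultimately have "Legendre z q = - 1"
    by (simp add: Legendre_def)
  then show ?thesis ..
qed

lemma bij_betw_mult_mod:
  fixes p :: nat
  assumes "p > 0" "coprime m (int p)"
  shows "bij_betw (\<lambda>k. nat ((m * int k) mod int p)) {..<p} {..<p}"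
proof -
  let ?s = "\<lambda>k. nat ((m * int k) mod int p)"
  have "inj_on ?s {..<p}"
  proof (rule inj_onI)
    fix a b assume ab: "a \<in> {..<p}" "b \<in> {..<p}" "?s a = ?s b"
    then have "[m * int a = m * int b] (mod int p)"
      using assms(1) by (simp add: cong_def eq_nat_nat_iff)
    then have "[int a = int b] (mod int p)"
      using assms(2) by (simp add: cong_mult_lcancel)
    then show "a = b"
      using ab by (simp add: cong_def)
  qed
  moreover have "?s ` {..<p} \<subseteq> {..<p}"
    using assms(1) by (auto simp: nat_less_iff)
  ultimately show ?thesis
    by (simp add: bij_betw_def endo_inj_surj)
qed

text \<open>Over F_2, [j - t in N] = 1 + [j - t in Q] + [j = t]. When this is summed over j in
  \<open>S\<close>, orthogonality to the all-one word kills the first term and orthogonality to the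
  shift of r_Q by t kills the second.\<close>

lemma dual_word_eq_convolution:
  assumes S: "S \<subseteq> {..<p}" and t: "t < p"
    and dual: "\<forall>c\<in>qr_code p. (\<Sum>i\<in>S. c $ i) = 0"
  shows "(\<Sum>j\<in>S. of_bool (Legendre (int j - int t) (int p) = - 1)) = (of_bool (t \<in> S) :: bit)"
proof -
  have fin: "finite S"
    using S finite_subset by blast
  have "(\<Sum>j\<in>S. vec p (\<lambda>_. 1 :: bit) $ j) = 0"
    using dual qr_code_all_one by blast
  moreover have "(\<Sum>j\<in>S. vec p (\<lambda>_. 1 :: bit) $ j) = (\<Sum>j\<in>S. 1)"
    by (rule sum.cong) (use S in auto)
  ultimately have one: "(\<Sum>j\<in>S. 1 :: bit) = 0"
    by simp
  have "(\<Sum>j\<in>S. vec p (\<lambda>i. of_bool (Legendre (int i - int t) (int p) = 1) :: bit) $ j) = 0"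
    using dual qr_code_shift[of p t] t by auto
  moreover have "(\<Sum>j\<in>S. vec p (\<lambda>i. of_bool (Legendre (int i - int t) (int p) = 1) :: bit) $ j)
      = (\<Sum>j\<in>S. of_bool (Legendre (int j - int t) (int p) = 1))"
    by (rule sum.cong) (use S in auto)
  ultimately have res: "(\<Sum>j\<in>S. of_bool (Legendre (int j - int t) (int p) = 1) :: bit) = 0"
    by simp
  have "(\<Sum>j\<in>S. of_bool (Legendre (int j - int t) (int p) = - 1) :: bit)
      = (\<Sum>j\<in>S. 1 + of_bool (Legendre (int j - int t) (int p) = 1) + of_bool (j = t))"
  proof (rule sum.cong)
    fix j assume "j \<in> S"
    then have "j < p"
      using S by auto
    then have "[int j = int t] (mod int p) \<longleftrightarrow> j = t"
      using t by (simp add: cong_def)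
    then have "[int j - int t = 0] (mod int p) \<longleftrightarrow> j = t"
      by (simp add: cong_diff_iff_cong_0)
    then show "(of_bool (Legendre (int j - int t) (int p) = - 1) :: bit)
        = 1 + of_bool (Legendre (int j - int t) (int p) = 1) + of_bool (j = t)"
      by (auto simp: Legendre_def)
  qed simp
  also have "\<dots> = (\<Sum>j\<in>S. of_bool (j = t))"
    by (simp only: sum.distrib one res add_0_left)
  also have "\<dots> = of_bool (t \<in> S)"
    using fin by (simp add: of_bool_def sum.delta' sum.delta)
  finally show ?thesis .
qed

text \<open>If \<open>w\<close> is orthogonal to the code, then \<open>w\<^sub>t = \<Sum>\<^sub>j w\<^sub>j [j - t \<in> N]\<close>. Substituting
  \<open>i \<mapsto> - n i\<close> with \<open>n \<in> N\<close> turns this into \<open>u\<^sub>i = \<Sum>\<^sub>k u\<^sub>k [i - k \<in> Q]\<close>, which exhibits the permuted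
  word \<open>u\<close> as a sum of cyclic shifts of \<open>r\<^sub>Q\<close>.\<close>

lemma dual_word_permuted_in_qr_code:
  assumes p: "prime p" "2 < p" and S: "S \<subseteq> {..<p}"
    and dual: "\<forall>c\<in>qr_code p. (\<Sum>i\<in>S. c $ i) = 0"
  obtains s where "bij_betw s {..<p} {..<p}" "vec p (\<lambda>i. of_bool (s i \<in> S)) \<in> qr_code p"
proof -
  have q: "prime (int p)" "2 < int p"
    using p by simp_all
  obtain n where n: "Legendre n (int p) = - 1"
    using exists_quadratic_nonresidue[OF q] by blast
  have "\<not> int p dvd - n"
    using n by (auto simp: Legendre_def cong_0_iff split: if_splits)
  then have cop: "coprime (- n) (int p)"
    using q(1) by (metis coprime_commute prime_imp_coprime)
  \<comment> \<open>With this multiplier, s k - s i = n (i - k) modulo p: the minus sign reverses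
    the difference, and the nonresidue \<open>n\<close> exchanges residues and nonresidues.\<close>
  define s where "s k = nat ((- n * int k) mod int p)" for k
  have s_cong: "[int (s k) = - n * int k] (mod int p)" for k
    using p(2) by (simp add: s_def)
  have bij: "bij_betw s {..<p} {..<p}"
    using bij_betw_mult_mod[OF _ cop] p(2) by (simp add: s_def[abs_def])
  \<comment> \<open>\<open>K\<close> is the support of the permuted word.\<close>
  define K where "K = {k \<in> {..<p}. s k \<in> S}"
  have "s ` K = S"
    using bij S by (auto simp: K_def bij_betw_def)
  then have bijK: "bij_betw s K S"
    using bij by (auto simp: K_def bij_betw_def inj_on_def)
  have leg: "Legendre (int (s k) - int (s i)) (int p) = - 1 \<longleftrightarrow> Legendre (int i - int k) (int p) = 1"
    for i k
  proof -
    have "[int (s k) - int (s i) = - n * int k - - n * int i] (mod int p)"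
      by (intro cong_diff s_cong)
    then have "Legendre (int (s k) - int (s i)) (int p) = Legendre (n * (int i - int k)) (int p)"
      by (intro Legendre_cong) (simp add: algebra_simps)
    then show ?thesis
      by (simp add: Legendre_mult[OF p] n)
  qed
  have "vec p (\<lambda>i. of_bool (s i \<in> S) :: bit)
      = vec p (\<lambda>i. \<Sum>k\<in>K. of_bool (Legendre (int i - int k) (int p) = 1))"
  proof (rule eq_vecI)
    fix i assume "i < dim_vec (vec p (\<lambda>i. \<Sum>k\<in>K. of_bool (Legendre (int i - int k) (int p) = 1) :: bit))"
    then have i: "i < p"
      by simp
    then have "s i < p"
      using bij by (auto simp: bij_betw_def)
    then have "(of_bool (s i \<in> S) :: bit)
        = (\<Sum>j\<in>S. of_bool (Legendre (int j - int (s i)) (int p) = - 1))"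
      using dual_word_eq_convolution[OF S _ dual] by simp
    also have "\<dots> = (\<Sum>k\<in>K. of_bool (Legendre (int (s k) - int (s i)) (int p) = - 1))"
      by (rule sum.reindex_bij_betw[OF bijK, symmetric])
    finally show "vec p (\<lambda>i. of_bool (s i \<in> S) :: bit) $ i
        = vec p (\<lambda>i. \<Sum>k\<in>K. of_bool (Legendre (int i - int k) (int p) = 1)) $ i"
      using i by (simp add: leg)
  qed simp
  moreover have "vec p (\<lambda>i. \<Sum>k\<in>K. of_bool (Legendre (int i - int k) (int p) = 1)) \<in> qr_code p"
    using p(2) by (intro qr_code_sum qr_code_shift) (simp_all add: K_def)
  ultimately show thesis
    using that bij by simp
qed

lemma dual_support_card_le:
  assumes p: "prime p" "2 < p" and S: "S \<subseteq> {..<p}"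
    and dual: "\<forall>c\<in>qr_code p. (\<Sum>i\<in>S. c $ i) = 0"
  shows "card S + min_distance (qr_code p) \<le> p"
proof -
  obtain s where bij: "bij_betw s {..<p} {..<p}"
    and u: "vec p (\<lambda>i. of_bool (s i \<in> S)) \<in> qr_code p"
    using dual_word_permuted_in_qr_code[OF p S dual] .
  have le: "card S \<le> p"
    using card_mono[OF _ S] by simp
  let ?w = "vec p (\<lambda>i. of_bool (s i \<notin> S)) :: bit vec"
  \<comment> \<open>Adding the all-one word complements the support.\<close>
  have "?w = vec p (\<lambda>i. of_bool (s i \<in> S)) + vec p (\<lambda>_. 1)"
    by (rule eq_vecI) auto
  then have w: "?w \<in> qr_code p"
    using u qr_code_add qr_code_all_one by simp
  have "bij_betw s {i \<in> {..<p}. s i \<notin> S} ({..<p} - S)"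
    using bij by (auto simp: bij_betw_def inj_on_def)
  then have "card {i \<in> {..<p}. s i \<notin> S} = card ({..<p} - S)"
    by (rule bij_betw_same_card)
  also have "\<dots> = p - card S"
    using S by (simp add: card_Diff_subset finite_subset)
  also have "{i \<in> {..<p}. s i \<notin> S} = {i. i < dim_vec ?w \<and> ?w $ i \<noteq> 0}"
    by auto
  finally have weight: "hamming_weight ?w = p - card S"
    by (simp add: hamming_weight_def)
  \<comment> \<open>\<open>min_distance\<close> discards weight 0, so the complement must be
    nonzero. If \<open>S\<close> were the full coordinate set, orthogonality to the all-one word
    would make \<open>p\<close> even.\<close>
  have "card S \<noteq> p"
  proof
    assume "card S = p"
    then have "S = {..<p}"
      using S by (intro card_subset_eq) auto
    moreover have "(\<Sum>i\<in>S. vec p (\<lambda>_. 1 :: bit) $ i) = 0"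
      using dual qr_code_all_one by blast
    ultimately have "(of_nat p :: bit) = 0"
      by simp
    moreover have "odd p"
      using p prime_odd_nat by blast
    ultimately show False
      by (auto elim!: oddE)
  qed
  then have "hamming_weight ?w \<noteq> 0"
    using weight le by simp
  then have "p - card S \<in> hamming_weight ` qr_code p - {0}"
    using w weight by (metis DiffI image_eqI singletonD)
  moreover have "finite (qr_code p)"
    using finite_subset[OF qr_code_subset finite_carrier_vec_bit] .
  ultimately have "min_distance (qr_code p) \<le> p - card S"
    unfolding min_distance_def by (intro Min_le) auto
  then show ?thesis
    using le by simp
qed

theorem theorem3p18:
  fixes p d :: nat and C :: "bit vec set"
  assumes "prime p"
    and "[int p = 1] (mod 8) \<or> [int p = -1] (mod 8)"
    and "C = qr_code p"
    and "d = min_distance C"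
  shows "(var_x + var_y) ^ d dvd weight_polynomial p C"
proof -
  have "p \<noteq> 2"
    using assms(2) by (auto simp: cong_def)
  then have "2 < p"
    using prime_ge_2_nat[OF assms(1)] by simp
  then show ?thesis
    unfolding assms(3,4)
    by (intro power_dvd_weight_polynomial qr_code_subset qr_code_add dual_support_card_le assms(1))
qed

end
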